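(* Let $n\ge 2$ and let $s\in\mathbb Z_+$ with $s\ge 1$. Then there exists $P_o\in P_{s,s}$ such that $P_o^{-1}(0)\subseteq\mathbb C^n$ is a non-harmonic complex cone.
   Context: $\mathbb Z_+$ denotes the non-negative integers. For $p,q\in\mathbb Z_+$, $P_{p,q}$ is the space of polynomials on $\mathbb C^n$ of the form $P(z)=\sum_{|\alpha|=p}\sum_{|\beta|=q}c_{\alpha\beta}z^\alpha\bar z^\beta$ ($c_{\alpha\beta}\in\mathbb C$, $\alpha,\beta\in\mathbb Z_+^n$ multi-indices), and $H_{p,q}=\{P\in P_{p,q}:\Delta P=0\}$, where $\Delta=4\sum_{k=1}^n\frac{\partial^2}{\partial z_k\partial\bar z_k}$. A set $C\subseteq\mathbb C^n$ is a complex cone if $\lambda C\subseteq C$ for all $\lambda\in\mathbb C$. A complex cone $C$ is called non-harmonic if it is not contained in the zero set $P^{-1}(0)$ of any nonzero bi-graded homogeneous harmonic polynomial $P$, i.e. of any nonzero $P\in H_{p,q}$, for any $p,q\in\mathbb Z_+$. *)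

theory Defs
  imports "HOL-Analysis.Analysis"
begin

definition multi_indices :: "nat \<Rightarrow> ('n::finite \<Rightarrow> nat) set" where
  "multi_indices p = {\<alpha>. (\<Sum>k\<in>UNIV. \<alpha> k) = p}"

(* Guarantees that the sums over multi-indices below are genuine finite sums. *)
lemma finite_multi_indices: "finite (multi_indices p :: ('n::finite \<Rightarrow> nat) set)"
proof (rule finite_subset)
  show "multi_indices p \<subseteq> PiE (UNIV :: 'n set) (\<lambda>_. {..p})"
    by (auto simp: multi_indices_def intro!: member_le_sum)
  show "finite (PiE (UNIV :: 'n set) (\<lambda>_. {..p}))"
    by (intro finite_PiE) auto
qed

definition monomial_power :: "complex ^ 'n \<Rightarrow> ('n::finite \<Rightarrow> nat) \<Rightarrow> complex" where
  "monomial_power z \<alpha> = (\<Prod>k\<in>UNIV. (z $ k) ^ \<alpha> k)"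

(* Polynomials in z and its conjugate are represented by the functions they induce on C^n;
   such a function determines its coefficients, so the zero polynomial is the zero function. *)
definition bihom_polys :: "nat \<Rightarrow> nat \<Rightarrow> (complex ^ 'n::finite \<Rightarrow> complex) set" where
  "bihom_polys p q = {P. \<exists>c :: ('n \<Rightarrow> nat) \<Rightarrow> ('n \<Rightarrow> nat) \<Rightarrow> complex. \<forall>z.
     P z = (\<Sum>\<alpha>\<in>multi_indices p. \<Sum>\<beta>\<in>multi_indices q.
              c \<alpha> \<beta> * monomial_power z \<alpha> * cnj (monomial_power z \<beta>))}"

(* Wirtinger derivatives (d/dx_k - i d/dy_k)/2 and (d/dx_k + i d/dy_k)/2 for z_k = x_k + i y_k,
   computed from the real Frechet derivative in the directions e_k and i e_k. *)
definition wirtinger_deriv ::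
    "'n::finite \<Rightarrow> (complex ^ 'n \<Rightarrow> complex) \<Rightarrow> complex ^ 'n \<Rightarrow> complex" where
  "wirtinger_deriv k f z =
     (frechet_derivative f (at z) (axis k 1) - \<i> * frechet_derivative f (at z) (axis k \<i>)) / 2"

definition wirtinger_cnj_deriv ::
    "'n::finite \<Rightarrow> (complex ^ 'n \<Rightarrow> complex) \<Rightarrow> complex ^ 'n \<Rightarrow> complex" where
  "wirtinger_cnj_deriv k f z =
     (frechet_derivative f (at z) (axis k 1) + \<i> * frechet_derivative f (at z) (axis k \<i>)) / 2"

definition complex_laplacian ::
    "(complex ^ 'n::finite \<Rightarrow> complex) \<Rightarrow> complex ^ 'n \<Rightarrow> complex" where
  "complex_laplacian f z = 4 * (\<Sum>k\<in>UNIV. wirtinger_deriv k (wirtinger_cnj_deriv k f) z)"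

definition harmonic_bihom_polys :: "nat \<Rightarrow> nat \<Rightarrow> (complex ^ 'n::finite \<Rightarrow> complex) set" where
  "harmonic_bihom_polys p q = {P \<in> bihom_polys p q. \<forall>z. complex_laplacian P z = 0}"

definition complex_cone :: "(complex ^ 'n::finite) set \<Rightarrow> bool" where
  "complex_cone C \<longleftrightarrow> (\<forall>c. (\<lambda>z. c *s z) ` C \<subseteq> C)"

definition nonharmonic_complex_cone :: "(complex ^ 'n::finite) set \<Rightarrow> bool" where
  "nonharmonic_complex_cone C \<longleftrightarrow> complex_cone C \<and>
     (\<forall>p q. \<forall>P \<in> harmonic_bihom_polys p q. P \<noteq> (\<lambda>z. 0) \<longrightarrow> \<not> C \<subseteq> P -` {0})"

end

theory Submission
  imports Defs
begin

text \<open>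
  The polynomial is \<open>P\<^sub>o = (\<bar>z\<^sub>a\<bar>\<^sup>2 - t \<bar>z\<^sub>b\<bar>\<^sup>2)\<^sup>s\<close> for two different coordinates \<open>a\<close>, \<open>b\<close>
  and a real number \<open>t > 0\<close> outside a certain countable set. Its zero set is the cone
  \<open>\<bar>z\<^sub>a\<bar>\<^sup>2 = t \<bar>z\<^sub>b\<bar>\<^sup>2\<close> for every \<open>s \<ge> 1\<close>.

  Let \<open>H = \<Sum> c(\<alpha>,\<beta>) z\<^sup>\<alpha> cnj z\<^sup>\<beta>\<close> be harmonic and vanish on this cone. Both conditions become linear
  relations between the coefficients, by one principle: distinct characters of a monoid are linearly
  independent (\<open>character_class_sum_eq_0\<close>). Under componentwise multiplication every
  \<open>z\<^sup>\<alpha> cnj z\<^sup>\<beta>\<close> is a character of \<open>\<complex>\<^sup>n\<close>, and different exponents give different characters. So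
  harmonicity says that (\<open>harmonic_coefficient_relation\<close>), for all \<open>\<alpha>\<close>, \<open>\<beta>\<close>,
  \<open>\<Sum>\<^sub>k (\<alpha>\<^sub>k + 1) (\<beta>\<^sub>k + 1) c(\<alpha> + e\<^sub>k, \<beta> + e\<^sub>k) = 0\<close>.
  The cone is a rescaled copy of the submonoid \<open>\<bar>z\<^sub>a\<bar> = \<bar>z\<^sub>b\<bar>\<close>. On that submonoid two monomials agree
  exactly if one arises from the other by trading powers of \<open>\<bar>z\<^sub>a\<bar>\<^sup>2\<close> for powers of
  \<open>\<bar>z\<^sub>b\<bar>\<^sup>2\<close>. Hence, if \<open>c\<^sub>0, \<dots>, c\<^sub>N\<close> are the coefficients along such a family of monomials, vanishing
  on the cone says \<open>\<Sum> c\<^sub>i t\<^sup>i = 0\<close> (\<open>cone_coefficient_relation\<close>).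

  Suppose that \<open>H\<close> is nonzero and choose a nonzero coefficient of least degree in the variables
  \<open>z\<^sub>a\<close>, \<open>z\<^sub>b\<close> and their conjugates. In the harmonic relations that link its family, the terms with
  \<open>k\<close> different from \<open>a\<close> and \<open>b\<close> have smaller degree in these variables, hence vanish. What remains
  is a two-term recurrence, which determines \<open>c\<^sub>0, \<dots>, c\<^sub>N\<close> up to a common nonzero factor. Then
  \<open>\<Sum> c\<^sub>i t\<^sup>i = 0\<close> says that \<open>t\<close> is a root of \<open>jacobi_type_poly\<close>, a nonzero polynomial given by
  five natural numbers. These polynomials have countably many roots in all, and \<open>t\<close> is chosen to avoid
  them.
\<close>

section \<open>Linear independence of characters\<close>

text \<open>
  Linear independence of characters, for families that may contain a character several times: the
  coefficients of equal members add up to zero. Replacing \<open>f x\<close> by \<open>f (y * x) - \<chi>\<^sub>j y * f x\<close>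
  multiplies the coefficient of \<open>\<chi>\<^sub>i\<close> by \<open>\<chi>\<^sub>i y - \<chi>\<^sub>j y\<close>. If \<open>\<chi>\<^sub>j\<close> differs from the selected
  character at \<open>y\<close>, this removes \<open>\<chi>\<^sub>j\<close> and multiplies all coefficients of the selected character
  by the same nonzero factor. Repeating this for all unwanted \<open>j\<close> leaves the selected class only.
\<close>

lemma character_class_sum_eq_0:
  fixes \<phi> :: "'i \<Rightarrow> 'a::monoid_mult \<Rightarrow> 'b::idom"
  assumes "finite I" and "1 \<in> M" and mult_closed: "\<And>x y. x \<in> M \<Longrightarrow> y \<in> M \<Longrightarrow> x * y \<in> M"
    and one: "\<And>i. i \<in> I \<Longrightarrow> \<phi> i 1 = 1"
    and mult: "\<And>i x y. i \<in> I \<Longrightarrow> x \<in> M \<Longrightarrow> y \<in> M \<Longrightarrow> \<phi> i (x * y) = \<phi> i x * \<phi> i y"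
    and zero: "\<And>x. x \<in> M \<Longrightarrow> (\<Sum>i\<in>I. a i * \<phi> i x) = 0"
  shows "(\<Sum>i | i \<in> I \<and> (\<forall>x\<in>M. \<phi> i x = \<psi> x). a i) = 0"
proof -
  define J where "J = {i \<in> I. \<exists>x\<in>M. \<phi> i x \<noteq> \<psi> x}"
  have "\<forall>j\<in>J. \<exists>y\<in>M. \<phi> j y \<noteq> \<psi> y" by (auto simp: J_def)
  then obtain y where y: "\<And>j. j \<in> J \<Longrightarrow> y j \<in> M" "\<And>j. j \<in> J \<Longrightarrow> \<phi> j (y j) \<noteq> \<psi> (y j)"
    by metis
  have fin: "finite J" using assms(1) by (simp add: J_def)
  have sift: "(\<Sum>i\<in>I. a i * (\<Prod>j\<in>K. \<phi> i (y j) - \<phi> j (y j)) * \<phi> i x) = 0"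
    if "K \<subseteq> J" "x \<in> M" for K x
    using finite_subset[OF that(1) fin] that
  proof (induction K arbitrary: x rule: finite_induct)
    case empty
    then show ?case by (simp add: zero)
  next
    case (insert k K)
    then have yk: "y k \<in> M" using y by auto
    let ?p = "\<lambda>i. a i * (\<Prod>j\<in>K. \<phi> i (y j) - \<phi> j (y j))"
    have "(\<Sum>i\<in>I. a i * (\<Prod>j\<in>insert k K. \<phi> i (y j) - \<phi> j (y j)) * \<phi> i x)
        = (\<Sum>i\<in>I. ?p i * \<phi> i (y k * x) - \<phi> k (y k) * (?p i * \<phi> i x))"
      using insert yk by (intro sum.cong) (auto simp: mult algebra_simps)
    also have "\<dots> = (\<Sum>i\<in>I. ?p i * \<phi> i (y k * x)) - \<phi> k (y k) * (\<Sum>i\<in>I. ?p i * \<phi> i x)"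
      by (simp add: sum_subtractf sum_distrib_left)
    also have "\<dots> = 0"
      using insert yk mult_closed by simp
    finally show ?case .
  qed
  define d where "d = (\<Prod>j\<in>J. \<psi> (y j) - \<phi> j (y j))"
  have "d \<noteq> 0" using y(2) fin by (simp add: d_def) metis
  have "0 = (\<Sum>i\<in>I. a i * (\<Prod>j\<in>J. \<phi> i (y j) - \<phi> j (y j)))"
    using sift[of J 1] assms(2) one by simp
  also have "\<dots> = (\<Sum>i\<in>I - J. a i * (\<Prod>j\<in>J. \<phi> i (y j) - \<phi> j (y j)))"
    using assms(1) fin by (intro sum.mono_neutral_right) (auto simp: J_def)
  also have "\<dots> = (\<Sum>i\<in>I - J. a i * d)"
    unfolding d_def using y by (intro sum.cong arg_cong2[of _ _ _ _ "(*)"] prod.cong) (auto simp: J_def)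
  also have "\<dots> = (\<Sum>i | i \<in> I \<and> (\<forall>x\<in>M. \<phi> i x = \<psi> x). a i) * d"
    unfolding sum_distrib_right by (intro sum.cong) (auto simp: J_def)
  finally show ?thesis using \<open>d \<noteq> 0\<close> by simp
qed

section \<open>Monomials in the variables and their conjugates, and their Laplacian\<close>

definition bimonomial :: "('n::finite \<Rightarrow> nat) \<Rightarrow> ('n \<Rightarrow> nat) \<Rightarrow> complex ^ 'n \<Rightarrow> complex" where
  "bimonomial \<alpha> \<beta> z = monomial_power z \<alpha> * cnj (monomial_power z \<beta>)"

lemma bimonomial_mult: "bimonomial \<alpha> \<beta> (x * y) = bimonomial \<alpha> \<beta> x * bimonomial \<alpha> \<beta> y"
  by (simp add: bimonomial_def monomial_power_def power_mult_distrib prod.distrib)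

lemma bimonomial_one: "bimonomial \<alpha> \<beta> 1 = 1"
  by (simp add: bimonomial_def monomial_power_def)

lemma bimonomial_altdef:
  "bimonomial \<alpha> \<beta> z = (\<Prod>k\<in>UNIV. (z $ k) ^ \<alpha> k * cnj (z $ k) ^ \<beta> k)"
  by (simp add: bimonomial_def monomial_power_def prod.distrib)

text \<open>
  In the derivative formulas below the truncated exponent \<open>0 - 1 = 0\<close> is harmless, because it always
  comes with the factor \<open>0\<close>.
\<close>

lemma monomial_power_has_derivative:
  "((\<lambda>z. monomial_power z \<alpha>) has_derivative
    (\<lambda>h. \<Sum>k\<in>UNIV. of_nat (\<alpha> k) * monomial_power z (\<alpha>(k := \<alpha> k - 1)) * h $ k)) (at z)"
proof -
  have "((\<lambda>z. \<Prod>k\<in>UNIV. (z $ k) ^ \<alpha> k) has_derivative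
    (\<lambda>h. \<Sum>k\<in>UNIV. (of_nat (\<alpha> k) * h $ k * (z $ k) ^ (\<alpha> k - 1)) * (\<Prod>j\<in>UNIV - {k}. (z $ j) ^ \<alpha> j))) (at z)"
    by (intro has_derivative_prod has_derivative_power bounded_linear_imp_has_derivative bounded_linear_vec_nth)
  moreover have "monomial_power z (\<alpha>(k := \<alpha> k - 1)) = (z $ k) ^ (\<alpha> k - 1) * (\<Prod>j\<in>UNIV - {k}. (z $ j) ^ \<alpha> j)" for k
    unfolding monomial_power_def by (subst prod.remove[of UNIV k]) auto
  ultimately show ?thesis
    by (simp add: monomial_power_def[abs_def] mult_ac)
qed

lemma bimonomial_has_derivative:
  "(bimonomial \<alpha> \<beta> has_derivative
    (\<lambda>h. (\<Sum>k\<in>UNIV. of_nat (\<alpha> k) * bimonomial (\<alpha>(k := \<alpha> k - 1)) \<beta> z * h $ k)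
       + (\<Sum>k\<in>UNIV. of_nat (\<beta> k) * bimonomial \<alpha> (\<beta>(k := \<beta> k - 1)) z * cnj (h $ k)))) (at z)"
  unfolding bimonomial_def
  by (rule has_derivative_eq_rhs,
      rule has_derivative_mult[OF monomial_power_has_derivative
        has_derivative_cnj[OF monomial_power_has_derivative]])
     (simp add: fun_eq_iff sum_distrib_left sum_distrib_right mult_ac add.commute)

lemma frechet_derivative_bimonomial_sum:
  assumes "finite I"
  shows "frechet_derivative (\<lambda>z. \<Sum>i\<in>I. c i * bimonomial (A i) (B i) z) (at z) (axis k x) =
    (\<Sum>i\<in>I. c i * (of_nat (A i k) * bimonomial ((A i)(k := A i k - 1)) (B i) z * x
       + of_nat (B i k) * bimonomial (A i) ((B i)(k := B i k - 1)) z * cnj x))"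
proof -
  have "((\<lambda>z. \<Sum>i\<in>I. c i * bimonomial (A i) (B i) z) has_derivative
    (\<lambda>h. \<Sum>i\<in>I. c i * ((\<Sum>k\<in>UNIV. of_nat (A i k) * bimonomial ((A i)(k := A i k - 1)) (B i) z * h $ k)
       + (\<Sum>k\<in>UNIV. of_nat (B i k) * bimonomial (A i) ((B i)(k := B i k - 1)) z * cnj (h $ k))))) (at z)"
    by (intro has_derivative_sum has_derivative_mult_right bimonomial_has_derivative)
  from frechet_derivative_at[OF this, symmetric] show ?thesis
    by (simp add: axis_def if_distrib[of cnj] if_distrib[of "(*) _"] cong: if_cong)
qed

lemma wirtinger_cnj_deriv_bimonomial_sum:
  assumes "finite I"
  shows "wirtinger_cnj_deriv k (\<lambda>z. \<Sum>i\<in>I. c i * bimonomial (A i) (B i) z) =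
    (\<lambda>z. \<Sum>i\<in>I. c i * of_nat (B i k) * bimonomial (A i) ((B i)(k := B i k - 1)) z)"
  unfolding wirtinger_cnj_deriv_def frechet_derivative_bimonomial_sum[OF assms] fun_eq_iff
  by (simp add: sum_distrib_left sum_divide_distrib flip: sum.distrib)
     (simp add: algebra_simps)

lemma wirtinger_deriv_bimonomial_sum:
  assumes "finite I"
  shows "wirtinger_deriv k (\<lambda>z. \<Sum>i\<in>I. c i * bimonomial (A i) (B i) z) =
    (\<lambda>z. \<Sum>i\<in>I. c i * of_nat (A i k) * bimonomial ((A i)(k := A i k - 1)) (B i) z)"
  unfolding wirtinger_deriv_def frechet_derivative_bimonomial_sum[OF assms] fun_eq_iff
  by (simp add: sum_distrib_left sum_divide_distrib flip: sum_subtractf)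
     (simp add: algebra_simps)

lemma complex_laplacian_bimonomial_sum:
  assumes "finite I"
  shows "complex_laplacian (\<lambda>z. \<Sum>i\<in>I. c i * bimonomial (A i) (B i) z) z =
    4 * (\<Sum>k\<in>UNIV. \<Sum>i\<in>I. c i * of_nat (A i k) * of_nat (B i k)
           * bimonomial ((A i)(k := A i k - 1)) ((B i)(k := B i k - 1)) z)"
  unfolding complex_laplacian_def wirtinger_cnj_deriv_bimonomial_sum[OF assms]
    wirtinger_deriv_bimonomial_sum[OF assms]
  by (simp add: mult_ac)


section \<open>When two monomials agree on the whole space or on a cone\<close>

lemma circle_power_eqD:
  assumes "\<And>u::complex. norm u = 1 \<Longrightarrow> u ^ m = u ^ n"
  shows "m = n"
proof -
  have False if "\<And>u::complex. norm u = 1 \<Longrightarrow> u ^ m = u ^ n" "m < n" for m n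
  proof -
    (* A unit with u ^ (n - m) = -1 separates the two powers. *)
    define u where "u = cis (pi / real (n - m))"
    have "u ^ (n - m) = -1" using that(2) by (simp add: u_def Complex.DeMoivre)
    then have "u ^ n = - (u ^ m)"
      using that(2) power_add[of u "n - m" m] by simp
    with that(1)[of u] show False by (simp add: u_def)
  qed
  then show ?thesis using assms by (metis linorder_neqE_nat)
qed

lemma circle_power_cnj_power_eqD:
  assumes "\<And>u. norm u = 1 \<Longrightarrow> u ^ m * cnj u ^ n = u ^ m' * cnj u ^ n'"
  shows "m + n' = m' + n"
proof (rule circle_power_eqD)
  fix u :: complex assume u: "norm u = 1"
  then have 1: "u * cnj u = 1" by (simp add: complex_norm_square[symmetric])
  have "u ^ (m + n') = u ^ m * cnj u ^ n * (u ^ n * u ^ n')"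
    using 1 by (simp add: power_add flip: power_mult_distrib)
       (simp add: mult_ac flip: power_mult_distrib)
  also have "\<dots> = u ^ m' * cnj u ^ n' * (u ^ n * u ^ n')"
    using assms[OF u] by simp
  also have "\<dots> = u ^ (m' + n)"
    using 1 by (simp add: power_add mult_ac) (simp add: mult_ac flip: power_mult_distrib)
  finally show "u ^ (m + n') = u ^ (m' + n)" .
qed

text \<open>
  Points with one common value \<open>x\<close> in the coordinates \<open>K\<close> and \<open>1\<close> elsewhere are enough to
  separate monomials: \<open>x = 2\<close> detects the sum of the exponents, and unit values \<open>x\<close> their
  difference.
\<close>

lemma bimonomial_if:
  "bimonomial \<alpha> \<beta> (\<chi> i. if i \<in> K then x else 1) = x ^ sum \<alpha> K * cnj x ^ sum \<beta> K"
proof -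
  have "bimonomial \<alpha> \<beta> (\<chi> i. if i \<in> K then x else 1)
      = (\<Prod>k\<in>UNIV. if k \<in> K then x ^ \<alpha> k * cnj x ^ \<beta> k else 1)"
    unfolding bimonomial_altdef by (intro prod.cong) auto
  then show ?thesis
    by (simp add: prod.If_cases prod.distrib power_sum)
qed

lemma bimonomial_eq_iff: "(\<forall>z. bimonomial \<alpha> \<beta> z = bimonomial \<alpha>' \<beta>' z) \<longleftrightarrow> \<alpha> = \<alpha>' \<and> \<beta> = \<beta>'"
proof
  assume eq: "\<forall>z. bimonomial \<alpha> \<beta> z = bimonomial \<alpha>' \<beta>' z"
  have "\<alpha> k = \<alpha>' k \<and> \<beta> k = \<beta>' k" for k
  proof -
    have *: "x ^ \<alpha> k * cnj x ^ \<beta> k = x ^ \<alpha>' k * cnj x ^ \<beta>' k" for x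
      using eq[rule_format, of "\<chi> i. if i \<in> {k} then x else 1"]
      unfolding bimonomial_if by simp
    from *[of 2] have "(2::complex) ^ (\<alpha> k + \<beta> k) = 2 ^ (\<alpha>' k + \<beta>' k)"
      by (simp add: power_add)
    then have "(of_nat (2 ^ (\<alpha> k + \<beta> k)) :: complex) = of_nat (2 ^ (\<alpha>' k + \<beta>' k))"
      by simp
    then have "(2::nat) ^ (\<alpha> k + \<beta> k) = 2 ^ (\<alpha>' k + \<beta>' k)"
      by (simp only: of_nat_eq_iff)
    then have "\<alpha> k + \<beta> k = \<alpha>' k + \<beta>' k" by simp
    moreover have "\<alpha> k + \<beta>' k = \<alpha>' k + \<beta> k"
      by (rule circle_power_cnj_power_eqD) (rule *)
    ultimately show ?thesis by linarith
  qed
  then show "\<alpha> = \<alpha>' \<and> \<beta> = \<beta>'" by auto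
qed simp

text \<open>
  Unit values may be put into any coordinate without leaving the cone, so all differences
  \<open>\<alpha> k - \<beta> k\<close> are determined. The value \<open>2\<close> must be put into \<open>a\<close> and \<open>b\<close> together, so for these two
  only the joint degree is determined.
\<close>

lemma bimonomial_eq_on_coneD:
  assumes eq: "\<And>z. norm (z $ a) = norm (z $ b) \<Longrightarrow> bimonomial \<alpha> \<beta> z = bimonomial \<alpha>' \<beta>' z"
    and "a \<noteq> b"
  shows "\<alpha> a + \<beta>' a = \<alpha>' a + \<beta> a" "\<alpha> b + \<beta>' b = \<alpha>' b + \<beta> b"
    "\<alpha> a + \<alpha> b + \<beta> a + \<beta> b = \<alpha>' a + \<alpha>' b + \<beta>' a + \<beta>' b"
    "k \<notin> {a, b} \<Longrightarrow> \<alpha> k = \<alpha>' k \<and> \<beta> k = \<beta>' k"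
proof -
  have test: "x ^ sum \<alpha> K * cnj x ^ sum \<beta> K = x ^ sum \<alpha>' K * cnj x ^ sum \<beta>' K"
    if "(a \<in> K \<longleftrightarrow> b \<in> K) \<or> norm x = 1" for x K
    using that eq[of "\<chi> i. if i \<in> K then x else 1"] unfolding bimonomial_if by auto
  have degree: "sum \<alpha> K + sum \<beta> K = sum \<alpha>' K + sum \<beta>' K" if "a \<in> K \<longleftrightarrow> b \<in> K" for K
  proof -
    have "(of_nat (2 ^ (sum \<alpha> K + sum \<beta> K)) :: complex) = of_nat (2 ^ (sum \<alpha>' K + sum \<beta>' K))"
      using test[of K 2] that by (simp add: power_add)
    then have "(2::nat) ^ (sum \<alpha> K + sum \<beta> K) = 2 ^ (sum \<alpha>' K + sum \<beta>' K)"
      by (simp only: of_nat_eq_iff)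
    then show ?thesis by simp
  qed
  have weight: "\<alpha> k + \<beta>' k = \<alpha>' k + \<beta> k" for k
    using circle_power_cnj_power_eqD[of "\<alpha> k" "\<beta> k" "\<alpha>' k" "\<beta>' k"] test[of "{k}"] by simp
  show "\<alpha> a + \<beta>' a = \<alpha>' a + \<beta> a" "\<alpha> b + \<beta>' b = \<alpha>' b + \<beta> b"
    by (rule weight)+
  show "\<alpha> a + \<alpha> b + \<beta> a + \<beta> b = \<alpha>' a + \<alpha>' b + \<beta>' a + \<beta>' b"
    using degree[of "{a, b}"] \<open>a \<noteq> b\<close> by simp
  show "\<alpha> k = \<alpha>' k \<and> \<beta> k = \<beta>' k" if "k \<notin> {a, b}"
    using degree[of "{k}"] weight[of k] that by auto
qed

lemma bimonomial_fun_upd2: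
  assumes "a \<noteq> b"
  shows "bimonomial (\<alpha>(a := m, b := n)) (\<beta>(a := m', b := n')) z =
    (z $ a) ^ m * cnj (z $ a) ^ m' * ((z $ b) ^ n * cnj (z $ b) ^ n') *
    (\<Prod>k\<in>UNIV - {a, b}. (z $ k) ^ \<alpha> k * cnj (z $ k) ^ \<beta> k)"
proof -
  have "UNIV = insert a (insert b (UNIV - {a, b}))" by auto
  then have "bimonomial (\<alpha>(a := m, b := n)) (\<beta>(a := m', b := n')) z =
    prod (\<lambda>k. (z $ k) ^ ((\<alpha>(a := m, b := n)) k) * cnj (z $ k) ^ ((\<beta>(a := m', b := n')) k))
     (insert a (insert b (UNIV - {a, b})))"
    unfolding bimonomial_altdef by simp
  also have "\<dots> = (z $ a) ^ m * cnj (z $ a) ^ m' * ((z $ b) ^ n * cnj (z $ b) ^ n') *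
    (\<Prod>k\<in>UNIV - {a, b}. (z $ k) ^ ((\<alpha>(a := m, b := n)) k) * cnj (z $ k) ^ ((\<beta>(a := m', b := n')) k))"
    using assms by (simp add: mult.assoc)
  also have "(\<Prod>k\<in>UNIV - {a, b}. (z $ k) ^ ((\<alpha>(a := m, b := n)) k) * cnj (z $ k) ^ ((\<beta>(a := m', b := n')) k))
     = (\<Prod>k\<in>UNIV - {a, b}. (z $ k) ^ \<alpha> k * cnj (z $ k) ^ \<beta> k)"
    by (intro prod.cong) auto
  finally show ?thesis .
qed

text \<open>
  The \<open>i\<close>-th exponent of a family in which weight \<open>N\<close> is distributed between the coordinates \<open>a\<close> and
  \<open>b\<close>. Used for \<open>\<alpha>\<close> and for \<open>\<beta>\<close> with the same \<open>i\<close>, it multiplies a fixed monomial by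
  \<open>\<bar>z\<^sub>a\<bar>\<close> to the power \<open>2 i\<close> and \<open>\<bar>z\<^sub>b\<bar>\<close> to the power \<open>2 (N - i)\<close>.
\<close>

definition slide :: "'n \<Rightarrow> 'n \<Rightarrow> nat \<Rightarrow> nat \<Rightarrow> ('n \<Rightarrow> nat) \<Rightarrow> nat \<Rightarrow> nat \<Rightarrow> 'n \<Rightarrow> nat" where
  "slide a b m n \<alpha> N i = \<alpha>(a := m + i, b := n + (N - i))"

text \<open>
  A class of monomials that agree on the cone \<open>\<bar>z\<^sub>a\<bar> = \<bar>z\<^sub>b\<bar>\<close> is one family of slid exponents. That
  one of \<open>m\<close>, \<open>m'\<close> and one of \<open>n\<close>, \<open>n'\<close> is zero makes the family complete: no further factor
  \<open>\<bar>z\<^sub>a\<bar>\<^sup>2\<close> or \<open>\<bar>z\<^sub>b\<bar>\<^sup>2\<close> is hidden in the fixed part.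
\<close>

lemma bimonomial_eq_on_cone_iff:
  fixes a b :: "'n::finite"
  assumes "a \<noteq> b" "m = 0 \<or> m' = 0" "n = 0 \<or> n' = 0"
  shows "(\<forall>z\<in>{z. norm (z $ a) = norm (z $ b)}. bimonomial \<alpha>' \<beta>' z
            = bimonomial (slide a b m n \<alpha> N 0) (slide a b m' n' \<beta> N 0) z)
     \<longleftrightarrow> (\<exists>i\<le>N. \<alpha>' = slide a b m n \<alpha> N i \<and> \<beta>' = slide a b m' n' \<beta> N i)"
proof
  assume "\<forall>z\<in>{z. norm (z $ a) = norm (z $ b)}. bimonomial \<alpha>' \<beta>' z
            = bimonomial (slide a b m n \<alpha> N 0) (slide a b m' n' \<beta> N 0) z"
  then have "bimonomial \<alpha>' \<beta>' z = bimonomial (slide a b m n \<alpha> N 0) (slide a b m' n' \<beta> N 0) z"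
    if "norm (z $ a) = norm (z $ b)" for z using that by simp
  note D = bimonomial_eq_on_coneD[OF this \<open>a \<noteq> b\<close>]
  define i where "i = \<alpha>' a - m"
  have ia: "\<alpha>' a = m + i" "\<beta>' a = m' + i"
    using D(1) assms unfolding i_def slide_def by auto
  define j where "j = \<alpha>' b - n"
  have jb: "\<alpha>' b = n + j" "\<beta>' b = n' + j"
    using D(2) assms unfolding j_def slide_def by auto
  have "i + j = N"
    using D(3) ia jb assms(1) unfolding slide_def by simp
  then have "i \<le> N" "j = N - i" by auto
  moreover have "\<alpha>' = slide a b m n \<alpha> N i" "\<beta>' = slide a b m' n' \<beta> N i"
    using D(4) ia jb \<open>j = N - i\<close> by (auto simp: slide_def fun_eq_iff)
  ultimately show "\<exists>i\<le>N. \<alpha>' = slide a b m n \<alpha> N i \<and> \<beta>' = slide a b m' n' \<beta> N i" by blast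
next
  assume "\<exists>i\<le>N. \<alpha>' = slide a b m n \<alpha> N i \<and> \<beta>' = slide a b m' n' \<beta> N i"
  then obtain i where i: "i \<le> N" "\<alpha>' = slide a b m n \<alpha> N i" "\<beta>' = slide a b m' n' \<beta> N i" by blast
  show "\<forall>z\<in>{z. norm (z $ a) = norm (z $ b)}. bimonomial \<alpha>' \<beta>' z
            = bimonomial (slide a b m n \<alpha> N 0) (slide a b m' n' \<beta> N 0) z"
  proof
    fix z :: "complex ^ 'n" assume "z \<in> {z. norm (z $ a) = norm (z $ b)}"
    then have "z $ a * cnj (z $ a) = z $ b * cnj (z $ b)"
      by (simp add: complex_norm_square[symmetric])
    then have "(z $ a * cnj (z $ a)) ^ i * (z $ b * cnj (z $ b)) ^ (N - i) = (z $ b * cnj (z $ b)) ^ N"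
      using i(1) by (simp flip: power_add)
    then have "(z $ a) ^ (m + i) * cnj (z $ a) ^ (m' + i) * ((z $ b) ^ (n + (N - i)) * cnj (z $ b) ^ (n' + (N - i)))
      = (z $ a) ^ m * cnj (z $ a) ^ m' * ((z $ b) ^ (n + N) * cnj (z $ b) ^ (n' + N))"
      by (simp add: power_add power_mult_distrib mult_ac)
    then show "bimonomial \<alpha>' \<beta>' z
            = bimonomial (slide a b m n \<alpha> N 0) (slide a b m' n' \<beta> N 0) z"
      unfolding i slide_def bimonomial_fun_upd2[OF \<open>a \<noteq> b\<close>] by simp
  qed
qed


section \<open>Harmonicity and vanishing on the cone as relations between coefficients\<close>

text \<open>
  This compares coefficients of \<open>z\<^sup>\<alpha> cnj z\<^sup>\<beta>\<close> in the Laplacian. The sum there runs over pairs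
  \<open>(k, x)\<close> of a coordinate and an exponent, and different pairs may give the same monomial.
\<close>

lemma harmonic_coefficient_relation:
  fixes c :: "('n::finite \<Rightarrow> nat) \<times> ('n \<Rightarrow> nat) \<Rightarrow> complex"
  assumes "finite I" and supp: "\<And>x. x \<notin> I \<Longrightarrow> c x = 0"
    and harm: "\<And>z. complex_laplacian (\<lambda>z. \<Sum>x\<in>I. c x * bimonomial (fst x) (snd x) z) z = 0"
  shows "(\<Sum>k\<in>UNIV. of_nat (Suc (\<alpha> k)) * of_nat (Suc (\<beta> k))
            * c (\<alpha>(k := Suc (\<alpha> k)), \<beta>(k := Suc (\<beta> k)))) = 0"
proof -
  define lower :: "'n \<Rightarrow> ('n \<Rightarrow> nat) \<Rightarrow> 'n \<Rightarrow> nat" where "lower k \<gamma> = \<gamma>(k := \<gamma> k - 1)" for k \<gamma>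
  define d where "d k x = c x * of_nat (fst x k) * of_nat (snd x k)" for k x
  define C where "C = {(k, x). x \<in> I \<and> lower k (fst x) = \<alpha> \<and> lower k (snd x) = \<beta>}"
  have "(\<Sum>(k, x)\<in>UNIV \<times> I. d k x * bimonomial (lower k (fst x)) (lower k (snd x)) z) = 0" for z
    using harm[of z] unfolding complex_laplacian_bimonomial_sum[OF \<open>finite I\<close>]
    by (simp add: sum.cartesian_product d_def lower_def)
  then have "(\<Sum>kx | kx \<in> UNIV \<times> I \<and> (\<forall>z\<in>UNIV.
      (case kx of (k, x) \<Rightarrow> bimonomial (lower k (fst x)) (lower k (snd x))) z = bimonomial \<alpha> \<beta> z).
      case kx of (k, x) \<Rightarrow> d k x) = 0"
    using \<open>finite I\<close>
    by (intro character_class_sum_eq_0) (auto simp: bimonomial_one bimonomial_mult case_prod_unfold)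
  also have "{kx. kx \<in> UNIV \<times> I \<and> (\<forall>z\<in>UNIV.
      (case kx of (k, x) \<Rightarrow> bimonomial (lower k (fst x)) (lower k (snd x))) z = bimonomial \<alpha> \<beta> z)} = C"
    by (auto simp: C_def bimonomial_eq_iff)
  (* The class C may also contain pairs whose exponent was truncated at 0, but there d is 0. Conversely,
     an exponent outside of I contributes nothing because its coefficient is 0. *)
  also have "(\<Sum>kx\<in>C. case kx of (k, x) \<Rightarrow> d k x)
    = (\<Sum>kx\<in>(\<lambda>k. (k, \<alpha>(k := Suc (\<alpha> k)), \<beta>(k := Suc (\<beta> k)))) ` UNIV. case kx of (k, x) \<Rightarrow> d k x)"
  proof (rule sum.mono_neutral_cong)
    show "finite C"
      by (rule finite_subset[of _ "UNIV \<times> I"]) (auto simp: C_def \<open>finite I\<close>)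
    show "(case kx of (k, x) \<Rightarrow> d k x) = 0"
      if "kx \<in> range (\<lambda>k. (k, \<alpha>(k := Suc (\<alpha> k)), \<beta>(k := Suc (\<beta> k)))) - C" for kx
      using that by (auto simp: C_def lower_def d_def intro!: supp)
    show "(case kx of (k, x) \<Rightarrow> d k x) = 0"
      if "kx \<in> C - range (\<lambda>k. (k, \<alpha>(k := Suc (\<alpha> k)), \<beta>(k := Suc (\<beta> k))))" for kx
    proof (rule ccontr)
      obtain k \<alpha>' \<beta>' where kx: "kx = (k, \<alpha>', \<beta>')" by (cases kx) auto
      assume "\<not> (case kx of (k, x) \<Rightarrow> d k x) = 0"
      then have "\<alpha>' k > 0" "\<beta>' k > 0" by (auto simp: kx d_def)
      moreover have "\<alpha> = lower k \<alpha>'" "\<beta> = lower k \<beta>'" using that by (auto simp: kx C_def)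
      ultimately have "\<alpha>' = \<alpha>(k := Suc (\<alpha> k))" "\<beta>' = \<beta>(k := Suc (\<beta> k))"
        by (auto simp: lower_def)
      with that kx show False by auto
    qed
  qed auto
  also have "\<dots> = (\<Sum>k\<in>UNIV. d k (\<alpha>(k := Suc (\<alpha> k)), \<beta>(k := Suc (\<beta> k))))"
    by (subst sum.reindex) (auto simp: inj_on_def)
  finally show ?thesis by (simp add: d_def mult_ac)
qed

lemma bimonomial_rescale:
  "bimonomial \<alpha> \<beta> (\<chi> i. if i = a then of_real \<tau> * z $ i else z $ i)
     = of_real \<tau> ^ (\<alpha> a + \<beta> a) * bimonomial \<alpha> \<beta> z"
  unfolding bimonomial_altdef
  by (subst (1 2) prod.remove[of UNIV a]) (auto simp: power_mult_distrib power_add)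

text \<open>
  Multiplying the coordinate \<open>a\<close> by \<open>\<tau> = sqrt t\<close> maps the submonoid \<open>\<bar>z\<^sub>a\<bar> = \<bar>z\<^sub>b\<bar>\<close> onto the
  given cone and multiplies each monomial by a power of \<open>\<tau>\<close>. Within one class the exponents of these
  powers are \<open>m + m' + 2 i\<close>, so up to a common factor they are the powers of \<open>t\<close>.
\<close>

lemma cone_coefficient_relation:
  fixes c :: "('n::finite \<Rightarrow> nat) \<times> ('n \<Rightarrow> nat) \<Rightarrow> complex"
  assumes "finite I" and supp: "\<And>x. x \<notin> I \<Longrightarrow> c x = 0"
    and van: "\<And>z. norm (z $ a) ^ 2 = t * norm (z $ b) ^ 2 \<Longrightarrow>
       (\<Sum>x\<in>I. c x * bimonomial (fst x) (snd x) z) = 0"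
    and "t > 0" "a \<noteq> b" "m = 0 \<or> m' = 0" "n = 0 \<or> n' = 0"
  shows "(\<Sum>i\<le>N. c (slide a b m n \<alpha> N i, slide a b m' n' \<beta> N i) * of_real t ^ i) = 0"
proof -
  define \<tau> where "\<tau> = sqrt t"
  have \<tau>: "\<tau> > 0" "\<tau> ^ 2 = t" using \<open>t > 0\<close> by (auto simp: \<tau>_def)
  define M where "M = {z :: complex ^ 'n. norm (z $ a) = norm (z $ b)}"
  define C where "C = {x \<in> I. \<forall>z\<in>M. bimonomial (fst x) (snd x) z
     = bimonomial (slide a b m n \<alpha> N 0) (slide a b m' n' \<beta> N 0) z}"
  let ?s = "\<lambda>i. (slide a b m n \<alpha> N i, slide a b m' n' \<beta> N i)"
  have C_iff: "x \<in> C \<longleftrightarrow> x \<in> I \<and> x \<in> ?s ` {..N}" for x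
    unfolding C_def M_def using bimonomial_eq_on_cone_iff[OF assms(5-7), of "fst x" "snd x" \<alpha> N \<beta>]
    by (cases x) (auto simp: image_iff)
  have "(\<Sum>x\<in>I. c x * of_real \<tau> ^ (fst x a + snd x a) * bimonomial (fst x) (snd x) z) = 0"
    if "z \<in> M" for z
    using van[of "\<chi> i. if i = a then of_real \<tau> * z $ i else z $ i"] that \<tau> \<open>a \<noteq> b\<close>
    by (simp add: M_def bimonomial_rescale norm_mult power_mult_distrib mult_ac)
  then have "(\<Sum>x\<in>C. c x * of_real \<tau> ^ (fst x a + snd x a)) = 0"
    unfolding C_def using \<open>finite I\<close>
    by (intro character_class_sum_eq_0) (auto simp: bimonomial_one bimonomial_mult M_def norm_mult)
  also have "(\<Sum>x\<in>C. c x * of_real \<tau> ^ (fst x a + snd x a))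
    = (\<Sum>x\<in>?s ` {..N}. c x * of_real \<tau> ^ (fst x a + snd x a))"
    using supp by (intro sum.mono_neutral_left) (auto simp: C_iff)
  also have "\<dots> = (\<Sum>i\<le>N. c (?s i) * of_real \<tau> ^ (m + i + (m' + i)))"
    using \<open>a \<noteq> b\<close> by (subst sum.reindex) (auto simp: inj_on_def slide_def fun_eq_iff dest: spec[of _ a])
  also have "\<dots> = of_real \<tau> ^ (m + m') * (\<Sum>i\<le>N. c (?s i) * of_real t ^ i)"
    unfolding sum_distrib_left \<tau>(2)[symmetric]
    by (intro sum.cong refl) (simp add: power_add power2_eq_square power_mult_distrib mult_ac)
  finally show ?thesis using \<tau>(1) by simp
qed

section \<open>The exceptional parameters\<close>

definition slide_weight :: "nat \<Rightarrow> nat \<Rightarrow> nat \<Rightarrow> nat \<Rightarrow> nat \<Rightarrow> nat \<Rightarrow> real" where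
  "slide_weight m m' n n' N i = fact (m + i) * fact (m' + i) * fact (n + (N - i)) * fact (n' + (N - i))"

text \<open>
  If \<open>m = 0 \<or> m' = 0\<close> and \<open>n = 0 \<or> n' = 0\<close>, then, for \<open>t = (1 - x) / (1 + x)\<close> and up to a constant
  and a power of \<open>1 + x\<close>, this is the Jacobi polynomial in \<open>x\<close> of degree \<open>N\<close> with parameters
  \<open>m + m'\<close> and \<open>n + n'\<close>. Its coefficients solve the recurrence that harmonicity imposes in the
  variables \<open>z\<^sub>a\<close>, \<open>z\<^sub>b\<close>.
\<close>

definition jacobi_type_poly :: "nat \<Rightarrow> nat \<Rightarrow> nat \<Rightarrow> nat \<Rightarrow> nat \<Rightarrow> real poly" where
  "jacobi_type_poly m m' n n' N = (\<Sum>i\<le>N. monom ((-1) ^ i / slide_weight m m' n n' N i) i)"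

lemma slide_weight_nonzero: "slide_weight m m' n n' N i \<noteq> 0"
  by (simp add: slide_weight_def)

lemma poly_jacobi_type_poly:
  "poly (jacobi_type_poly m m' n n' N) t = (\<Sum>i\<le>N. (-1) ^ i / slide_weight m m' n n' N i * t ^ i)"
  by (simp add: jacobi_type_poly_def poly_sum poly_monom)

lemma jacobi_type_poly_nonzero: "jacobi_type_poly m m' n n' N \<noteq> 0"
proof
  assume "jacobi_type_poly m m' n n' N = 0"
  then have "poly (jacobi_type_poly m m' n n' N) 0 = 0" by simp
  then show False
    by (simp add: poly_jacobi_type_poly slide_weight_nonzero power_0_left if_distrib cong: if_cong)
qed

lemma ex_pos_nonroot:
  fixes F :: "'i::countable \<Rightarrow> real poly"
  assumes "\<And>i. F i \<noteq> 0"
  shows "\<exists>t>0. \<forall>i. poly (F i) t \<noteq> 0"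
proof -
  have "countable (\<Union>i. {t. poly (F i) t = 0})"
    using assms by (intro countable_UN) (auto intro: countable_finite poly_roots_finite)
  moreover have "uncountable {0<..<1::real}"
    by (simp add: uncountable_open_interval)
  ultimately have "\<not> {0<..<1} \<subseteq> (\<Union>i. {t. poly (F i) t = 0})"
    using countable_subset by blast
  then show ?thesis by auto
qed

section \<open>Harmonic polynomials that vanish on the cone\<close>

text \<open>
  The core of the argument. A nonzero coefficient of least degree in the variables belonging to \<open>a\<close>
  and \<open>b\<close> lies in a family whose coefficients satisfy the recurrence of a harmonic polynomial of
  \<open>z\<^sub>a\<close> and \<open>z\<^sub>b\<close> alone. The factorials in \<open>slide_weight\<close> turn that recurrence into a mere change
  of sign, which makes the coefficients explicit.
\<close>

lemma harmonic_vanishing_on_cone_coefficients: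
  fixes c :: "('n::finite \<Rightarrow> nat) \<times> ('n \<Rightarrow> nat) \<Rightarrow> complex"
  assumes "finite I" and supp: "\<And>x. x \<notin> I \<Longrightarrow> c x = 0"
    and harm: "\<And>z. complex_laplacian (\<lambda>z. \<Sum>x\<in>I. c x * bimonomial (fst x) (snd x) z) z = 0"
    and van: "\<And>z. norm (z $ a) ^ 2 = t * norm (z $ b) ^ 2 \<Longrightarrow>
       (\<Sum>x\<in>I. c x * bimonomial (fst x) (snd x) z) = 0"
    and "t > 0" "a \<noteq> b"
    and generic: "\<And>m m' n n' N. poly (jacobi_type_poly m m' n n' N) t \<noteq> 0"
  shows "c x = 0"
proof (rule ccontr)
  assume "c x \<noteq> 0"
  define deg where "deg y = fst y a + snd y a + fst y b + snd y b" for y :: "('n \<Rightarrow> nat) \<times> ('n \<Rightarrow> nat)"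
  obtain y where y: "c y \<noteq> 0" and minimal: "\<And>y'. c y' \<noteq> 0 \<Longrightarrow> deg y \<le> deg y'"
    using ex_has_least_nat[of "\<lambda>y. c y \<noteq> 0" x deg] \<open>c x \<noteq> 0\<close> by auto
  obtain \<alpha> \<beta> where [simp]: "y = (\<alpha>, \<beta>)" by (cases y)
  define i\<^sub>0 where "i\<^sub>0 = min (\<alpha> a) (\<beta> a)"
  define j\<^sub>0 where "j\<^sub>0 = min (\<alpha> b) (\<beta> b)"
  define m m' n n' N where defs: "m = \<alpha> a - i\<^sub>0" "m' = \<beta> a - i\<^sub>0" "n = \<alpha> b - j\<^sub>0" "n' = \<beta> b - j\<^sub>0" "N = i\<^sub>0 + j\<^sub>0"
  define A where "A = slide a b m n \<alpha> N"
  define B where "B = slide a b m' n' \<beta> N"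
  define W where "W i = complex_of_real (slide_weight m m' n n' N i)" for i
  have ends: "m = 0 \<or> m' = 0" "n = 0 \<or> n' = 0"
    by (auto simp: defs i\<^sub>0_def j\<^sub>0_def)
  have y_eq: "A i\<^sub>0 = \<alpha>" "B i\<^sub>0 = \<beta>"
    by (auto simp: A_def B_def slide_def defs i\<^sub>0_def j\<^sub>0_def fun_eq_iff)
  have deg_y: "deg y = m + m' + n + n' + 2 * N"
    by (simp add: deg_def defs i\<^sub>0_def j\<^sub>0_def)
  have step: "c (A (Suc i), B (Suc i)) * W (Suc i) = - (c (A i, B i) * W i)" if "i < N" for i
  proof -
    (* The exponents that become members i and i + 1 of the family when raised at b and at a. Raising
       them at any other coordinate gives degree deg y - 2. *)
    define \<alpha>' where "\<alpha>' = \<alpha>(a := m + i, b := n + (N - Suc i))"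
    define \<beta>' where "\<beta>' = \<beta>(a := m' + i, b := n' + (N - Suc i))"
    define T where "T k = of_nat (Suc (\<alpha>' k)) * of_nat (Suc (\<beta>' k))
            * c (\<alpha>'(k := Suc (\<alpha>' k)), \<beta>'(k := Suc (\<beta>' k)))" for k
    have "T k = 0" if "k \<notin> {a, b}" for k
    proof -
      have "deg (\<alpha>'(k := Suc (\<alpha>' k)), \<beta>'(k := Suc (\<beta>' k))) < deg y"
        using that \<open>i < N\<close> \<open>a \<noteq> b\<close> unfolding deg_y by (auto simp: deg_def \<alpha>'_def \<beta>'_def)
      then have "c (\<alpha>'(k := Suc (\<alpha>' k)), \<beta>'(k := Suc (\<beta>' k))) = 0"
        using minimal linorder_not_le by blast
      then show ?thesis by (simp add: T_def)
    qed
    then have "sum T UNIV = sum T {a, b}"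
      by (intro sum.mono_neutral_right) auto
    also have "\<dots> = T a + T b" using \<open>a \<noteq> b\<close> by simp
    finally have "T a + T b = 0"
      using harmonic_coefficient_relation[OF assms(1-3), of \<alpha>' \<beta>'] by (simp add: T_def)
    moreover have "\<alpha>'(a := Suc (\<alpha>' a)) = A (Suc i)" "\<beta>'(a := Suc (\<beta>' a)) = B (Suc i)"
      using \<open>a \<noteq> b\<close> by (auto simp: \<alpha>'_def \<beta>'_def A_def B_def slide_def fun_eq_iff)
    then have "T a = of_nat (Suc (m + i)) * of_nat (Suc (m' + i)) * c (A (Suc i), B (Suc i))"
      using \<open>a \<noteq> b\<close> by (simp only: T_def) (simp add: \<alpha>'_def \<beta>'_def)
    moreover have Suc_b: "Suc (\<alpha>' b) = n + (N - i)" "Suc (\<beta>' b) = n' + (N - i)"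
      using \<open>i < N\<close> by (auto simp: \<alpha>'_def \<beta>'_def)
    have "\<alpha>'(b := Suc (\<alpha>' b)) = A i" "\<beta>'(b := Suc (\<beta>' b)) = B i"
      unfolding Suc_b by (simp_all add: \<alpha>'_def \<beta>'_def A_def B_def slide_def)
    then have "T b = of_nat (n + (N - i)) * of_nat (n' + (N - i)) * c (A i, B i)"
      by (simp only: T_def Suc_b)
    ultimately have rec: "of_nat (Suc (m + i)) * of_nat (Suc (m' + i)) * c (A (Suc i), B (Suc i))
       = - (of_nat (n + (N - i)) * of_nat (n' + (N - i)) * c (A i, B i))"
      by (simp add: eq_neg_iff_add_eq_0)
    define r where "r = N - Suc i"
    have r: "N - i = Suc r" using \<open>i < N\<close> by (simp add: r_def)
    define w :: complex where "w = fact (m + i) * fact (m' + i) * fact (n + r) * fact (n' + r)"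
    have "W i = w * (of_nat (n + (N - i)) * of_nat (n' + (N - i)))"
      unfolding W_def slide_weight_def w_def r by (simp add: algebra_simps)
    moreover have "W (Suc i) = w * (of_nat (Suc (m + i)) * of_nat (Suc (m' + i)))"
      unfolding W_def slide_weight_def w_def r_def[symmetric] by (simp add: algebra_simps)
    ultimately show ?thesis using arg_cong[OF rec, of "(*) w"] by (simp add: mult_ac)
  qed
  have alt: "c (A i, B i) * W i = (-1) ^ i * (c (A 0, B 0) * W 0)" if "i \<le> N" for i
    using that by (induction i) (simp_all add: step)
  have W: "W i \<noteq> 0" for i by (simp add: W_def slide_weight_nonzero)
  have coeff: "c (A i, B i) = c (A 0, B 0) * W 0 * ((-1) ^ i / W i)" if "i \<le> N" for i
    using alt[OF that] W[of i] by (simp add: field_simps)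
  have "0 = (\<Sum>i\<le>N. c (A i, B i) * of_real t ^ i)"
    using cone_coefficient_relation[OF assms(1,2) van \<open>t > 0\<close> \<open>a \<noteq> b\<close> ends, of \<alpha> N \<beta>]
    by (simp add: A_def B_def)
  also have "\<dots> = c (A 0, B 0) * W 0 * (\<Sum>i\<le>N. (-1) ^ i / W i * of_real t ^ i)"
    unfolding sum_distrib_left by (intro sum.cong refl) (subst coeff, auto)
  also have "\<dots> = c (A 0, B 0) * W 0 * of_real (poly (jacobi_type_poly m m' n n' N) t)"
    by (simp add: poly_jacobi_type_poly W_def)
  finally have "c (A 0, B 0) * W 0 = 0" using generic by simp
  then have "c (A i\<^sub>0, B i\<^sub>0) = 0" using coeff[of i\<^sub>0] by (simp add: defs)
  with y show False by (simp add: y_eq)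
qed

section \<open>The polynomial and its zero set\<close>

lemma bihom_polysI:
  fixes \<alpha> \<beta> :: "'i \<Rightarrow> 'n::finite \<Rightarrow> nat"
  assumes "finite J" and "\<And>j. j \<in> J \<Longrightarrow> \<alpha> j \<in> multi_indices p" "\<And>j. j \<in> J \<Longrightarrow> \<beta> j \<in> multi_indices q"
    and P: "\<And>z. P z = (\<Sum>j\<in>J. d j * bimonomial (\<alpha> j) (\<beta> j) z)"
  shows "P \<in> bihom_polys p q"
proof -
  let ?I = "multi_indices p \<times> multi_indices q :: (('n \<Rightarrow> nat) \<times> ('n \<Rightarrow> nat)) set"
  define c where "c \<alpha>' \<beta>' = (\<Sum>j | j \<in> J \<and> (\<alpha> j, \<beta> j) = (\<alpha>', \<beta>'). d j)" for \<alpha>' \<beta>'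
  have "P z = (\<Sum>x\<in>?I. \<Sum>j | j \<in> J \<and> (\<alpha> j, \<beta> j) = x. d j * bimonomial (\<alpha> j) (\<beta> j) z)" for z
    unfolding P using assms(1-3)
    by (intro sum.group[symmetric]) (auto simp: finite_multi_indices)
  also have "\<dots> z = (\<Sum>x\<in>?I. c (fst x) (snd x) * bimonomial (fst x) (snd x) z)" for z
    unfolding c_def sum_distrib_right by (intro sum.cong) auto
  finally show ?thesis
    unfolding bihom_polys_def bimonomial_def mult.assoc
    by (auto simp: sum.cartesian_product case_prod_unfold)
qed

text \<open>
  The coefficient function is extended by zero, so that raising an exponent never leaves its domain.
\<close>

lemma bihom_polysE:
  fixes P :: "complex ^ 'n::finite \<Rightarrow> complex"
  assumes "P \<in> bihom_polys p q"
  obtains I c where "finite I" "\<And>x. x \<notin> I \<Longrightarrow> c x = 0"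
    "P = (\<lambda>z. \<Sum>x\<in>I. c x * bimonomial (fst x) (snd x) z)"
proof -
  let ?I = "multi_indices p \<times> multi_indices q :: (('n \<Rightarrow> nat) \<times> ('n \<Rightarrow> nat)) set"
  obtain c where c: "\<And>z. P z = (\<Sum>\<alpha>\<in>multi_indices p. \<Sum>\<beta>\<in>multi_indices q.
              c \<alpha> \<beta> * monomial_power z \<alpha> * cnj (monomial_power z \<beta>))"
    using assms unfolding bihom_polys_def by blast
  show ?thesis
  proof
    show "finite ?I" by (simp add: finite_multi_indices)
    show "(if x \<in> ?I then c (fst x) (snd x) else 0) = 0" if "x \<notin> ?I" for x
      using that by simp
    show "P = (\<lambda>z. \<Sum>x\<in>?I. (if x \<in> ?I then c (fst x) (snd x) else 0) * bimonomial (fst x) (snd x) z)"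
      by (simp add: c fun_eq_iff sum.cartesian_product case_prod_unfold bimonomial_def mult.assoc)
  qed
qed

definition cone_poly :: "'n::finite \<Rightarrow> 'n \<Rightarrow> real \<Rightarrow> complex ^ 'n \<Rightarrow> complex" where
  "cone_poly a b t z = z $ a * cnj (z $ a) - of_real t * (z $ b * cnj (z $ b))"

lemma cone_poly_eq_0_iff: "cone_poly a b t z = 0 \<longleftrightarrow> norm (z $ a) ^ 2 = t * norm (z $ b) ^ 2"
proof -
  have "cone_poly a b t z = of_real (norm (z $ a) ^ 2 - t * norm (z $ b) ^ 2)"
    by (simp add: cone_poly_def complex_norm_square[symmetric])
  then show ?thesis by (simp only: of_real_eq_0_iff right_minus_eq)
qed

lemma cone_poly_power_in_bihom_polys:
  assumes "a \<noteq> b"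
  shows "(\<lambda>z. cone_poly a b t z ^ s) \<in> bihom_polys s s"
proof (rule bihom_polysI)
  define \<alpha> where "\<alpha> j = ((\<lambda>_. 0)(a := j, b := s - j))" for j :: nat
  show "\<alpha> j \<in> multi_indices s" if "j \<in> {..s}" for j
  proof -
    have "sum (\<alpha> j) UNIV = sum (\<alpha> j) {a, b}"
      by (intro sum.mono_neutral_right) (auto simp: \<alpha>_def)
    then show ?thesis using that assms by (simp add: multi_indices_def \<alpha>_def)
  qed
  then show "\<alpha> j \<in> multi_indices s" if "j \<in> {..s}" for j using that .
  show "cone_poly a b t z ^ s
    = (\<Sum>j\<le>s. (of_nat (s choose j) * (- of_real t) ^ (s - j)) * bimonomial (\<alpha> j) (\<alpha> j) z)" for z
  proof -
    have "cone_poly a b t z ^ s = (z $ a * cnj (z $ a) + (- of_real t) * (z $ b * cnj (z $ b))) ^ s"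
      by (simp add: cone_poly_def)
    also have "\<dots> = (\<Sum>j\<le>s. of_nat (s choose j) * (z $ a * cnj (z $ a)) ^ j
         * ((- of_real t) * (z $ b * cnj (z $ b))) ^ (s - j))"
      by (rule binomial_ring)
    also have "\<dots> = (\<Sum>j\<le>s. (of_nat (s choose j) * (- of_real t) ^ (s - j)) * bimonomial (\<alpha> j) (\<alpha> j) z)"
      unfolding \<alpha>_def bimonomial_fun_upd2[OF assms] power_mult_distrib
      by (intro sum.cong refl) (simp add: mult_ac)
    finally show ?thesis .
  qed
qed simp

theorem corollary3p5:
  fixes s :: nat
  assumes "CARD('n::finite) \<ge> 2" and "s \<ge> 1"
  shows "\<exists>P\<^sub>o :: complex ^ 'n \<Rightarrow> complex.
           P\<^sub>o \<in> bihom_polys s s \<and> P\<^sub>o \<noteq> (\<lambda>z. 0) \<and> nonharmonic_complex_cone (P\<^sub>o -` {0})"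
proof -
  obtain a b :: 'n where "a \<noteq> b"
    using assms(1) card_le_Suc0_iff_eq[of "UNIV :: 'n set"] by auto
  define F where "F = (\<lambda>(m, m', n, n', N). jacobi_type_poly m m' n n' N)"
  have "\<exists>t>0. \<forall>i. poly (F i) t \<noteq> 0"
    by (rule ex_pos_nonroot) (simp add: F_def jacobi_type_poly_nonzero split: prod.split)
  then obtain t where "t > 0" and t: "\<And>m m' n n' N. poly (jacobi_type_poly m m' n n' N) t \<noteq> 0"
    by (auto simp: F_def)
  define P where "P z = cone_poly a b t z ^ s" for z
  have zero_set: "P -` {0} = {z. norm (z $ a) ^ 2 = t * norm (z $ b) ^ 2}"
    using assms(2) by (auto simp: P_def cone_poly_eq_0_iff)
  have "P (axis a 1) = 1"
    using \<open>a \<noteq> b\<close> by (simp add: P_def cone_poly_def axis_def)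
  then have "P \<noteq> (\<lambda>z. 0)" by auto
  moreover have "P \<in> bihom_polys s s"
    unfolding P_def using \<open>a \<noteq> b\<close> by (rule cone_poly_power_in_bihom_polys)
  moreover have "complex_cone (P -` {0})"
    by (auto simp: complex_cone_def zero_set norm_mult power_mult_distrib)
  moreover have "H = (\<lambda>z. 0)" if "H \<in> harmonic_bihom_polys p q" "P -` {0} \<subseteq> H -` {0}" for p q H
  proof -
    have "H \<in> bihom_polys p q" using that(1) by (simp add: harmonic_bihom_polys_def)
    then obtain I c where *: "finite I" "\<And>x. x \<notin> I \<Longrightarrow> c x = 0"
      and H: "H = (\<lambda>z. \<Sum>x\<in>I. c x * bimonomial (fst x) (snd x) z)"
      by (rule bihom_polysE) (rule that)
    have "c x = 0" for x
    proof (rule harmonic_vanishing_on_cone_coefficients[OF * _ _ \<open>t > 0\<close> \<open>a \<noteq> b\<close> t])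
      show "complex_laplacian (\<lambda>z. \<Sum>x\<in>I. c x * bimonomial (fst x) (snd x) z) z = 0" for z
        using that(1) by (simp add: harmonic_bihom_polys_def H)
      show "(\<Sum>x\<in>I. c x * bimonomial (fst x) (snd x) z) = 0"
        if "norm (z $ a) ^ 2 = t * norm (z $ b) ^ 2" for z
        using \<open>P -` {0} \<subseteq> H -` {0}\<close> that unfolding zero_set H by auto
    qed
    then show ?thesis by (simp add: H)
  qed
  ultimately have "P \<in> bihom_polys s s \<and> P \<noteq> (\<lambda>z. 0) \<and> nonharmonic_complex_cone (P -` {0})"
    unfolding nonharmonic_complex_cone_def by metis
  then show ?thesis by (intro exI[of _ P])
qed

end
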